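(* Let $x=(x_1,x_2,\dots,x_n)$ be a binary sequence of length $n>53$ with $x_1=1$ whose first $53$ elements have run length encoding $(5,5,5,5,10,10,9,4)$ or $(5,5,10,5,15,5,4,1,3)$. Put $p=5$, $t=26$, and $z_j=x_{p(j-1)+1}$. Then $x_i=1$ for $1\le i\le p$, $x_{p+1}=-1$, and $x$ satisfies equation $(k)$ for all $1\le k\le t=26$, but $z$ does not satisfy equation $(k)$ for $k=5$, although $5\le\frac{t}{p}$.
   Context: A binary sequence of length $n$ is $x=(x_1,\dots,x_n)$ with each $x_i\in\{-1,1\}$. For $1\le k<\frac{n-1}{2}$, the sequence $x$ is said to satisfy equation $(k)$ if $$\frac{1+(-1)^{k+1}}{2}=\sum_{i=1}^{k}(-1)^{i+1}x_i x_{2k+2-i}.$$ Whether equation $(k)$ holds depends only on the first $2k+1$ elements of the sequence, so for the sequence $z$ the equation $(k)$ is to be read as this identity with $z_1,\dots,z_{2k+1}$ in place of $x_1,\dots,x_{2k+1}$. The run length encoding of a finite sequence is the list of the lengths of its successive maximal blocks of equal consecutive elements. *)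

theory Defs
  imports Complex_Main
begin

text \<open>
  A sequence \<open>x\<^sub>1, \<dots>, x\<^sub>n\<close> is a function on \<^typ>\<open>nat\<close> that is only inspected at the
  indices \<open>1, \<dots>, n\<close>.
\<close>

definition binary_seq :: "nat \<Rightarrow> (nat \<Rightarrow> int) \<Rightarrow> bool" where
  "binary_seq n x \<longleftrightarrow> (\<forall>i\<in>{1..n}. x i \<in> {-1, 1})"

text \<open>
  The division on the left is exact. For \<open>i \<le> k\<close> the index \<open>2 * k + 2 - i\<close> lies between
  \<open>k + 2\<close> and \<open>2 * k + 1\<close>, so the subtraction is not truncated and the equation only involves
  \<open>x\<^sub>1, \<dots>, x\<^bsub>2k+1\<^esub>\<close>. The side condition \<open>1 \<le> k < (n - 1) / 2\<close> is left to the places of use.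
\<close>

definition satisfies_eq :: "(nat \<Rightarrow> int) \<Rightarrow> nat \<Rightarrow> bool" where
  "satisfies_eq x k \<longleftrightarrow>
     (1 + (-1) ^ (k + 1)) div 2 = (\<Sum>i=1..k. (-1) ^ (i + 1) * x i * x (2 * k + 2 - i))"

function run_lengths :: "'a list \<Rightarrow> nat list" where
  "run_lengths [] = []"
| "run_lengths (a # as) =
     length (takeWhile (\<lambda>b. b = a) (a # as)) # run_lengths (dropWhile (\<lambda>b. b = a) as)"
  by pat_completeness auto
termination
  by (relation "measure length") (auto simp: le_imp_less_Suc length_dropWhile_le)

definition initial_segment :: "nat \<Rightarrow> (nat \<Rightarrow> 'a) \<Rightarrow> 'a list" where
  "initial_segment m x = map x [1..<m + 1]"

end

theory Submission
  imports Defs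
begin

text \<open>A sequence over \<open>{-1, 1}\<close> is determined by its first sign and its run
  lengths, so each of the two encodings leaves exactly one possible list of 53 entries
  (\<open>alternating_runs_run_lengths\<close>). Everything claimed about \<open>x\<close> and
  \<open>z\<close> depends on these entries alone (\<open>satisfies_eq_cong\<close>): equation (26)
  reaches index 53, and equation (5) for \<open>z\<close> reaches \<open>z 11\<close>, which is
  \<open>x 51\<close>. What remains is a finite evaluation for two explicit lists. For both of them
  the sum in equation (5) for \<open>z\<close> is -1, whereas the left side is 1.\<close>

fun alternating_runs :: "int \<Rightarrow> nat list \<Rightarrow> int list" where
  "alternating_runs a [] = []"
| "alternating_runs a (r # rs) = replicate r a @ alternating_runs (- a) rs"

lemma alternating_runs_run_lengths:
  assumes "set l \<subseteq> {-1, 1}" and "l = [] \<or> hd l = a"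
  shows "alternating_runs a (run_lengths l) = l"
  using assms
proof (induction l arbitrary: a rule: run_lengths.induct)
  case 1
  then show ?case by simp
next
  case (2 b bs)
  let ?t = "takeWhile (\<lambda>c. c = b) bs" and ?d = "dropWhile (\<lambda>c. c = b) bs"
  have "a = b" using "2.prems" by simp
  have d: "set ?d \<subseteq> {-1, 1}"
    using "2.prems"(1) by (auto dest: set_dropWhileD)
  \<comment> \<open>Maximality of the first block excludes \<open>b\<close> as the next entry; among
    -1 and 1 only \<open>- b\<close> is left.\<close>
  moreover have "?d = [] \<or> hd ?d = - b"
  proof (cases "?d = []")
    case False
    then have "hd ?d \<in> {-1, 1}" and "hd ?d \<noteq> b"
      using d hd_in_set[OF False] hd_dropWhile[OF False] by blast+
    moreover have "b \<in> {-1, 1}" using "2.prems"(1) by simp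
    ultimately show ?thesis by auto
  qed simp
  ultimately have "alternating_runs (- b) (run_lengths ?d) = ?d"
    by (intro "2.IH")
  moreover have "replicate (length ?t) b = ?t"
    by (intro replicate_length_same) (auto dest: set_takeWhileD)
  ultimately show ?case
    by (simp add: \<open>a = b\<close>)
qed

lemma satisfies_eq_cong:
  assumes "\<And>i. 1 \<le> i \<Longrightarrow> i \<le> 2 * k + 1 \<Longrightarrow> x i = y i"
  shows "satisfies_eq x k \<longleftrightarrow> satisfies_eq y k"
  using assms unfolding satisfies_eq_def by (intro arg_cong2[of _ _ _ _ "(=)"] sum.cong refl) auto

text \<open>A sum over an explicit list of indices lets the simplifier unfold the equation for
  numeral \<open>k\<close>.\<close>

lemma satisfies_eq_upt:
  "satisfies_eq x k \<longleftrightarrow>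
     (1 + (-1) ^ (k + 1)) div 2 =
     (\<Sum>i\<leftarrow>[1..<Suc k]. (-1) ^ (i + 1) * x i * x (2 * k + 2 - i))"
  unfolding satisfies_eq_def atLeastAtMost_upt sum_set_upt_conv_sum_list_nat ..

lemma nth_initial_segment:
  assumes "initial_segment m x = l" and "1 \<le> i" and "i \<le> m"
  shows "x i = l ! (i - 1)"
  using assms unfolding initial_segment_def by (auto simp del: upt_Suc)

text \<open>The whole claim as a property of one list, so that it can be evaluated. Lists are
  indexed from 0, hence \<open>i - 1\<close> for \<open>x i\<close>, and \<open>5 * (j - 1)\<close>
  for \<open>z j\<close>.\<close>

definition counterexample_prefix :: "int list \<Rightarrow> bool" where
  "counterexample_prefix l \<longleftrightarrow>
     (\<forall>i\<in>{1..5}. l ! (i - 1) = 1) \<and> l ! 5 = -1 \<and>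
     (\<forall>k\<in>{1..26}. satisfies_eq (\<lambda>i. l ! (i - 1)) k) \<and>
     \<not> satisfies_eq (\<lambda>j. l ! (5 * (j - 1))) 5"

lemma counterexample_prefix_1:
  "counterexample_prefix (alternating_runs 1 [5, 5, 5, 5, 10, 10, 9, 4])"
  by (simp add: counterexample_prefix_def satisfies_eq_upt atLeastAtMost_upt upt_rec_numeral
      numeral_nat)

lemma counterexample_prefix_2:
  "counterexample_prefix (alternating_runs 1 [5, 5, 10, 5, 15, 5, 4, 1, 3])"
  by (simp add: counterexample_prefix_def satisfies_eq_upt atLeastAtMost_upt upt_rec_numeral
      numeral_nat)

theorem mainTheorem3:
  fixes x z :: "nat \<Rightarrow> int" and n p t :: nat
  assumes "n > 53"
    and "binary_seq n x"
    and "x 1 = 1"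
    and "run_lengths (initial_segment 53 x) = [5, 5, 5, 5, 10, 10, 9, 4] \<or>
         run_lengths (initial_segment 53 x) = [5, 5, 10, 5, 15, 5, 4, 1, 3]"
    and "p = 5"
    and "t = 26"
    and "\<And>j. j \<ge> 1 \<Longrightarrow> z j = x (p * (j - 1) + 1)"
  shows "(\<forall>i\<in>{1..p}. x i = 1) \<and> x (p + 1) = -1 \<and>
         (\<forall>k\<in>{1..t}. satisfies_eq x k) \<and>
         \<not> satisfies_eq z 5 \<and> 5 \<le> real t / real p"
proof -
  define l where "l = initial_segment 53 x"
  have "set l \<subseteq> {-1, 1}"
    using assms(1,2) unfolding l_def initial_segment_def binary_seq_def by auto
  moreover have "hd l = 1"
    using assms(3) unfolding l_def initial_segment_def by (simp add: hd_map)
  ultimately have "alternating_runs 1 (run_lengths l) = l"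
    by (intro alternating_runs_run_lengths) auto
  then have prefix: "counterexample_prefix l"
    using assms(4) counterexample_prefix_1 counterexample_prefix_2 unfolding l_def by metis
  have x_eq: "x i = l ! (i - 1)" if "1 \<le> i" "i \<le> 53" for i
    using that nth_initial_segment[of 53 x l] l_def by simp
  have "satisfies_eq x k" if "k \<in> {1..26}" for k
    using that prefix satisfies_eq_cong[of k x "\<lambda>i. l ! (i - 1)"] x_eq
    unfolding counterexample_prefix_def by auto
  \<comment> \<open>The last index needed is 11 = 2 * 5 + 1, at list position 50, still inside the
    prefix.\<close>
  moreover have "z j = l ! (5 * (j - 1))" if "1 \<le> j" "j \<le> 11" for j
    using that assms(5,7) x_eq[of "5 * (j - 1) + 1"] by simp
  then have "\<not> satisfies_eq z 5"
    using prefix satisfies_eq_cong[of 5 z "\<lambda>j. l ! (5 * (j - 1))"]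
    unfolding counterexample_prefix_def by auto
  moreover have "\<forall>i\<in>{1..5}. x i = 1" "x 6 = -1"
    using prefix x_eq unfolding counterexample_prefix_def by auto
  ultimately show ?thesis
    using assms(5,6) by simp
qed

end
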